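(* Let $n\geq m\geq 2$ and $m\geq k\geq 1$ be integers. If $A$ is a complex $m\times n$ matrix that is nonnegative (all its entries are nonnegative real numbers), then $$\|A\|_{F_k}\leq \frac12\left(1+\sqrt{k}\right)\sqrt{mn}\,|A|_\infty.$$ Equality holds in this inequality if and only if $A$ is a scalar multiple of a $(0,1)$-matrix, the matrix $|A|_\infty\left(J_{m,n}-2A\right)$ is plain and has exactly $k$ nonzero singular values which are equal.
   Context: For a complex $m\times n$ matrix $A=[a_{ij}]$ with $m\le n$, $\sigma_1(A)\geq\cdots\geq\sigma_m(A)$ denote its singular values, i.e. the square roots of the eigenvalues of $AA^*$ (where $A^*$ is the Hermitian adjoint of $A$), listed with multiplicity; $\|A\|_{F_k}=\sigma_1(A)+\cdots+\sigma_k(A)$ is the Ky Fan $k$-norm; and $|A|_\infty=\max_{i,j}|a_{ij}|$. $J_{m,n}$ is the all-ones $m\times n$ matrix. Let $\mathbf{j}_m\in\mathbb{R}^m$ and $\mathbf{j}_n\in\mathbb{R}^n$ be the all-ones vectors. An $m\times n$ matrix $B$ is called plain if $\mathbf{j}_m$ and $\mathbf{j}_n$ are singular vectors to $\sigma_1(B)$, that is to say, $\sigma_1(B)=\langle \mathbf{j}_m,B\mathbf{j}_n\rangle/\sqrt{mn}$.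
   Formalization: The equality condition uses 2A - |A|_∞ J in place of |A|_∞(J - 2A), and A = 0 is listed as an extra case of equality; as printed the claim fails for k = 1 at A = J (since -J is not plain) and at A = J/2, and for every k at A = 0. *)

theory Defs
  imports
    "Jordan_Normal_Form.Schur_Decomposition"
    "HOL-Library.Nonpos_Ints"
begin

text \<open>
  The eigenvalues of \<open>A A\<^sup>*\<close> are counted with their algebraic multiplicity as roots of the
  characteristic polynomial, which for a Hermitian matrix agrees with the geometric one. They are
  nonnegative reals, so passing to the real part loses nothing. For an \<open>m \<times> n\<close> matrix the list
  has length \<open>m\<close>.
\<close>

definition singular_values :: "complex mat \<Rightarrow> real list" where
  "singular_values A =
     rev (sorted_list_of_multiset
       (image_mset (\<lambda>z. sqrt (Re z)) (proots (char_poly (A * mat_adjoint A)))))"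

text \<open>Indices start at 1, so \<open>singular_value 1\<close> is the largest.\<close>

definition singular_value :: "nat \<Rightarrow> complex mat \<Rightarrow> real" where
  "singular_value i A = singular_values A ! (i - 1)"

definition ky_fan_norm :: "nat \<Rightarrow> complex mat \<Rightarrow> real" where
  "ky_fan_norm k A = (\<Sum>i = 1..k. singular_value i A)"

definition max_norm :: "complex mat \<Rightarrow> real" where
  "max_norm A = Max (cmod ` elements_mat A)"

definition nonnegative_mat :: "complex mat \<Rightarrow> bool" where
  "nonnegative_mat A \<longleftrightarrow> elements_mat A \<subseteq> \<real>\<^sub>\<ge>\<^sub>0"

definition zero_one_mat :: "complex mat \<Rightarrow> bool" where
  "zero_one_mat A \<longleftrightarrow> elements_mat A \<subseteq> {0, 1}"

definition all_ones_vec :: "nat \<Rightarrow> complex vec" where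
  "all_ones_vec n = vec n (\<lambda>_. 1)"

definition all_ones_mat :: "nat \<Rightarrow> nat \<Rightarrow> complex mat" where
  "all_ones_mat m n = mat m n (\<lambda>_. 1)"

text \<open>
  The left-hand side is a real number, so it does not matter which argument of the inner product
  is conjugated.
\<close>

definition plain :: "complex mat \<Rightarrow> bool" where
  "plain B \<longleftrightarrow>
     complex_of_real (singular_value 1 B) =
       (all_ones_vec (dim_row B) \<bullet>c (B *\<^sub>v all_ones_vec (dim_col B))) /
       complex_of_real (sqrt (real (dim_row B) * real (dim_col B)))"

text \<open>
  The following predicate and \<open>plain\<close> are applied to \<open>2A - |A|\<^sub>\<infinity> J\<close>, and the zero matrix is
  listed as a separate case of equality. The source has \<open>|A|\<^sub>\<infinity> (J - 2A)\<close> and omits \<open>A = 0\<close>, which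
  cannot be meant. Take \<open>k = 1\<close>, where every constant matrix attains equality. For \<open>A = J\<close> the
  source's matrix is \<open>-J\<close>, which is not plain. For \<open>A = J/2\<close> it is \<open>0\<close>, which has no nonzero
  singular values.
\<close>

definition has_exactly_equal_nonzero_singular_values :: "nat \<Rightarrow> complex mat \<Rightarrow> bool" where
  "has_exactly_equal_nonzero_singular_values k B \<longleftrightarrow>
     (let nz = filter (\<lambda>s. s \<noteq> 0) (singular_values B)
      in length nz = k \<and> (\<forall>s \<in> set nz. \<forall>t \<in> set nz. s = t))"

end

theory Submission
  imports Defs
begin

text \<open>
  Put \<open>M = |A|\<^sub>\<infinity>\<close> and \<open>B = 2A - M J\<close>, a real matrix with entries in \<open>[-M, M]\<close>. From a singular
  value decomposition \<open>A = \<Sum>\<^sub>p s\<^sub>p u\<^sub>p v\<^sub>p\<^sup>*\<close> take \<open>W = \<Sum>\<^sub>p u\<^sub>p v\<^sub>p\<^sup>*\<close> over the \<open>k\<close> largest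
  singular values. Then twice the Ky Fan norm is \<open>Re \<langle>W, 2A\<rangle> = Re \<langle>W, B\<rangle> + M Re \<langle>W, J\<rangle>\<close>. As \<open>W\<close>
  has squared Frobenius norm at most \<open>k\<close>, the first term is at most \<open>M \<surd>(kmn)\<close> by Cauchy-Schwarz;
  as \<open>W\<close> is a contraction, the second is at most \<open>M \<surd>(mn)\<close>. Equality in Cauchy-Schwarz forces
  \<open>B = c W\<close> with \<open>c = M \<surd>(mn/k)\<close> and entries \<open>\<plusminus>M\<close>, so the singular values of \<open>B\<close> can be read off
  from \<open>W\<close>; equality in the second bound makes \<open>B\<close> plain. Conversely, if \<open>B\<close> has these properties,
  then \<open>W = B / c\<close> is a partial isometry of rank \<open>k\<close>, and testing \<open>2A\<close> against it gives a lower
  bound for the Ky Fan norm that meets the upper one.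
\<close>

section \<open>Unitary diagonalization of Hermitian matrices\<close>

lemma dim_mat_adjoint [simp]:
  "dim_row (mat_adjoint A) = dim_col A" "dim_col (mat_adjoint A) = dim_row A"
  by (simp_all add: mat_adjoint_def)

lemma mat_adjoint_carrier [simp]:
  "A \<in> carrier_mat m n \<Longrightarrow> mat_adjoint A \<in> carrier_mat n m"
  by auto

lemma mat_adjoint_index [simp]:
  "i < dim_col A \<Longrightarrow> j < dim_row A \<Longrightarrow> mat_adjoint A $$ (i, j) = conjugate (A $$ (j, i))"
  by (simp add: mat_adjoint_def mat_of_rows_def)

lemma mat_adjoint_mult:
  fixes A B :: "complex mat"
  assumes "dim_col A = dim_row B"
  shows "mat_adjoint (A * B) = mat_adjoint B * mat_adjoint A"
  using assms by (intro eq_matI) (auto simp: scalar_prod_def mult.commute intro!: sum.cong)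

lemma mat_adjoint_adjoint [simp]:
  fixes A :: "complex mat"
  shows "mat_adjoint (mat_adjoint A) = A"
  by (intro eq_matI) auto

lemma mat_adjoint_one [simp]: "mat_adjoint (1\<^sub>m n :: complex mat) = 1\<^sub>m n"
  by (intro eq_matI) auto

lemma unitary_mult_adjoint:
  fixes U :: "complex mat"
  assumes "U \<in> carrier_mat n n" "mat_adjoint U * U = 1\<^sub>m n"
  shows "U * mat_adjoint U = 1\<^sub>m n"
  using mat_mult_left_right_inverse[OF mat_adjoint_carrier[OF assms(1)] assms] .

lemma char_poly_unitary_conjugate:
  fixes A U :: "complex mat"
  assumes A: "A \<in> carrier_mat n n" and U: "U \<in> carrier_mat n n" "mat_adjoint U * U = 1\<^sub>m n"
  shows "char_poly (mat_adjoint U * A * U) = char_poly A"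
proof -
  have "similar_mat_wit (mat_adjoint U * A * U) A (mat_adjoint U) U"
  proof (rule similar_mat_witI[OF U(2) unitary_mult_adjoint[OF U] refl])
    show "mat_adjoint U * A * U \<in> carrier_mat n n"
      using A U by (intro mult_carrier_mat[of _ n n]) auto
  qed (use A U in auto)
  then show ?thesis by (intro char_poly_similar) (auto simp: similar_mat_def)
qed

text \<open>Complete \<open>v\<close> to a basis, apply Gram-Schmidt, which leaves the first vector
  untouched, and scale all resulting vectors to length 1. The scalar \<open>c\<close> arises as the
  reciprocal norm of \<open>v\<close>.\<close>

lemma unitary_with_first_column:
  fixes v :: "complex vec"
  assumes v: "v \<in> carrier_vec n" "v \<noteq> 0\<^sub>v n" and n: "n \<noteq> 0"
  obtains W c where "W \<in> carrier_mat n n" "mat_adjoint W * W = 1\<^sub>m n" "col W 0 = c \<cdot>\<^sub>v v"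
proof -
  interpret cof_vec_space n "TYPE(complex)" .
  define b where "b = basis_completion v"
  define ws where "ws = gram_schmidt n b"
  note bc = basis_completion[OF v, folded b_def]
  obtain vs where bv: "b = v # vs" using bc(6,7) n by (cases b) auto
  have ws: "set ws \<subseteq> carrier_vec n" "corthogonal ws" "length ws = n"
    using gram_schmidt_result[OF bc(2,4,5) refl, folded ws_def] bc(6) by auto
  have hd: "ws ! 0 = v"
    using gram_schmidt_hd[OF v(1), of vs, folded bv] ws(3) n unfolding ws_def
    by (metis hd_conv_nth length_0_conv)
  define d where "d w = complex_of_real (1 / sqrt (Re (w \<bullet>c w)))" for w :: "complex vec"
  define W where "W = mat_of_cols n (map (\<lambda>w. d w \<cdot>\<^sub>v w) ws)"
  have W: "W \<in> carrier_mat n n" using ws by (auto simp: W_def)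
  have Wi: "W $$ (i, j) = d (ws ! j) * ws ! j $ i" if "i < n" "j < n" for i j
    proof -
    have "dim_vec (ws ! j) = n" using subsetD[OF ws(1) nth_mem[of j ws]] ws(3) that by simp
    then show ?thesis using that ws by (simp add: W_def mat_of_cols_def)
  qed
  have "mat_adjoint W * W = 1\<^sub>m n"
  proof (rule eq_matI)
    fix i j assume "i < dim_row (1\<^sub>m n)" "j < dim_col (1\<^sub>m n :: complex mat)"
    then have ij: "i < n" "j < n" by auto
    have dims: "dim_vec (ws ! i) = n" "dim_vec (ws ! j) = n"
      using subsetD[OF ws(1) nth_mem] ws(3) ij by auto
    have "(mat_adjoint W * W) $$ (i, j) = (\<Sum>l = 0..<n. cnj (W $$ (l, i)) * W $$ (l, j))"
      using W mat_adjoint_carrier[OF W] ij by (simp add: scalar_prod_def)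
    also have "\<dots> = cnj (d (ws ! i)) * d (ws ! j) * (\<Sum>l = 0..<n. ws ! j $ l * cnj (ws ! i $ l))"
      using ij by (simp add: Wi sum_distrib_left mult_ac)
    also have "(\<Sum>l = 0..<n. ws ! j $ l * cnj (ws ! i $ l)) = ws ! j \<bullet>c ws ! i"
      using dims by (simp add: scalar_prod_def)
    finally have eq: "(mat_adjoint W * W) $$ (i, j) = cnj (d (ws ! i)) * d (ws ! j) * (ws ! j \<bullet>c ws ! i)" .
    show "(mat_adjoint W * W) $$ (i, j) = 1\<^sub>m n $$ (i, j)"
    proof (cases "i = j")
      case False
      then show ?thesis using eq ws(2,3) ij by (simp add: corthogonalD)
    next
      case True
      have nz: "ws ! i \<bullet>c ws ! i \<noteq> 0" using corthogonalD[OF ws(2), of i i] ws(3) ij by auto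
      have ge: "ws ! i \<bullet>c ws ! i \<ge> 0" by (rule conjugate_square_ge_0_vec)
      define r where "r = Re (ws ! i \<bullet>c ws ! i)"
      have r: "ws ! i \<bullet>c ws ! i = complex_of_real r" "r > 0"
        using nz ge unfolding r_def by (auto simp: complex_eq_iff less_eq_complex_def)
      have dr: "d (ws ! i) = complex_of_real (1 / sqrt r)" by (simp add: d_def r_def)
      have "1 / sqrt r * (1 / sqrt r) * r = 1" using r(2) by (simp add: field_simps)
      then have "complex_of_real (1 / sqrt r) * complex_of_real (1 / sqrt r) * complex_of_real r = 1"
        by (metis of_real_1 of_real_mult)
      then show ?thesis using ij eq unfolding True[symmetric] dr r(1) by simp
    qed
  qed (use W mat_adjoint_carrier[OF W] in auto)
  moreover have "col W 0 = d v \<cdot>\<^sub>v v"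
    using hd n W Wi v by (intro eq_vecI) auto
  ultimately show ?thesis using W that by blast
qed

text \<open>Deflation: in a unitary basis that starts with an eigenvector for the head of
  \<open>es\<close>, the matrix splits into a 1 by 1 block and a smaller Hermitian block, to which
  the induction hypothesis applies. The diagonal follows whatever order \<open>es\<close> has; this
  later puts the singular values in decreasing order.\<close>

theorem hermitian_unitary_diagonalization:
  fixes A :: "complex mat"
  assumes "A \<in> carrier_mat n n" "mat_adjoint A = A" "char_poly A = (\<Prod>e\<leftarrow>es. [:-e, 1:])"
  shows "\<exists>U \<in> carrier_mat n n. mat_adjoint U * U = 1\<^sub>m n \<and>
    mat_adjoint U * A * U = mat n n (\<lambda>(i, j). if i = j then es ! i else 0)"
  using assms
proof (induction es arbitrary: n A)
  case Nil
  then have "n = 0" using degree_monic_char_poly[of A n] by simp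
  then show ?case by (intro bexI[of _ "1\<^sub>m n"]) auto
next
  case (Cons e es)
  note A = Cons.prems(1)
  have len: "length (e # es) = n"
    using degree_monic_char_poly[OF A] degree_linear_factors[of uminus "e # es"] Cons.prems(3) by simp
  define k where "k = n - 1"
  have n: "n = Suc k" "length es = k" using len by (auto simp: k_def)
  have "eigenvalue A e" unfolding eigenvalue_root_char_poly[OF A] Cons.prems(3) by simp
  then obtain v where v: "v \<in> carrier_vec n" "v \<noteq> 0\<^sub>v n" "A *\<^sub>v v = e \<cdot>\<^sub>v v"
    using A unfolding eigenvalue_def eigenvector_def by auto
  obtain W c where W: "W \<in> carrier_mat n n" "mat_adjoint W * W = 1\<^sub>m n" and Wc: "col W 0 = c \<cdot>\<^sub>v v"
    using unitary_with_first_column[OF v(1,2)] n by blast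
  have W': "mat_adjoint W \<in> carrier_mat n n" using W by simp
  define B where "B = mat_adjoint W * A * W"
  have B: "B \<in> carrier_mat n n" using A W W' by (auto simp: B_def)
  have Badj: "mat_adjoint B = B"
    using A W W' Cons.prems(2)
    by (simp add: B_def mat_adjoint_mult assoc_mult_mat[of _ n n _ n _ n])
  have AW: "col (A * W) 0 = e \<cdot>\<^sub>v col W 0"
  proof -
    have "col (A * W) 0 = A *\<^sub>v col W 0" using A W n by (intro col_mult2) auto
    also have "\<dots> = c \<cdot>\<^sub>v (A *\<^sub>v v)" unfolding Wc using A v(1) by (rule mult_mat_vec)
    also have "\<dots> = e \<cdot>\<^sub>v col W 0" unfolding Wc v(3) by (simp only: smult_smult_assoc mult.commute)
    finally show ?thesis .
  qed
  have B0: "B $$ (i, 0) = (if i = 0 then e else 0)" if i: "i < n" for i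
  proof -
    have "B $$ (i, 0) = row (mat_adjoint W) i \<bullet> col (A * W) 0"
      using A W W' i n by (simp add: B_def assoc_mult_mat[of _ n n _ n _ n])
    also have "\<dots> = e * (row (mat_adjoint W) i \<bullet> col W 0)"
      unfolding AW using W W' i by (intro scalar_prod_smult_distrib[of _ n]) auto
    also have "row (mat_adjoint W) i \<bullet> col W 0 = (mat_adjoint W * W) $$ (i, 0)"
      using W W' i n by (intro index_mult_mat(1)[symmetric]) auto
    also have "\<dots> = (if i = 0 then 1 else 0)" unfolding W(2) using i n by auto
    finally show ?thesis by simp
  qed
  \<comment> \<open>Since \<open>B\<close> is Hermitian, the zeros of its first column carry over to
    its first row.\<close>
  have B0': "B $$ (0, i) = (if i = 0 then e else 0)" if "i < n" for i
    using mat_adjoint_index[of 0 B i] that B n B0[OF that] by (auto simp: Badj)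
  define C where "C = mat k k (\<lambda>(i, j). B $$ (Suc i, Suc j))"
  have C: "C \<in> carrier_mat k k" by (simp add: C_def)
  have BC: "B = four_block_mat (mat 1 1 (\<lambda>_. e)) (0\<^sub>m 1 k) (0\<^sub>m k 1) C"
    using B n by (intro eq_matI) (auto simp: B0 B0' C_def)
  have "[:-e, 1:] * (\<Prod>e\<leftarrow>es. [:-e, 1:]) = char_poly B"
    using char_poly_unitary_conjugate[OF A W] Cons.prems(3) by (simp add: B_def)
  also have "\<dots> = char_poly (mat 1 1 (\<lambda>_. e)) * char_poly C"
    unfolding BC by (rule char_poly_four_block_zeros_col) (use C in auto)
  also have "char_poly (mat 1 1 (\<lambda>_. e)) = [:-e, 1:]"
    by (simp add: char_poly_defs det_def sign_def)
  finally have cpC: "char_poly C = (\<Prod>e\<leftarrow>es. [:-e, 1:])"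
    by (metis mult_cancel_left pCons_eq_0_iff zero_neq_one)
  have "mat_adjoint C = C"
  proof (rule eq_matI)
    fix i j assume "i < dim_row C" "j < dim_col C"
    then have "i < k" "j < k" using C by auto
    then show "mat_adjoint C $$ (i, j) = C $$ (i, j)"
      using C B mat_adjoint_index[of "Suc i" B "Suc j"] n
      by (simp add: C_def Badj)
  qed (use C mat_adjoint_carrier[OF C] in auto)
  from Cons.IH[OF C this cpC] obtain P where P: "P \<in> carrier_mat k k" "mat_adjoint P * P = 1\<^sub>m k"
    and PC: "mat_adjoint P * C * P = mat k k (\<lambda>(i, j). if i = j then es ! i else 0)" by blast
  \<comment> \<open>Extending \<open>P\<close> by a 1 in the corner keeps the eigenvector in the
    first column of \<open>W * Q\<close> while the remaining block is diagonalized.\<close>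
  define Q where "Q = four_block_mat (1\<^sub>m 1) (0\<^sub>m 1 k) (0\<^sub>m k 1) P"
  have P': "mat_adjoint P \<in> carrier_mat k k" using P by simp
  have Q: "Q \<in> carrier_mat n n" using P n by (auto simp: Q_def intro!: carrier_matI)
  have Q'eq: "mat_adjoint Q = four_block_mat (1\<^sub>m 1) (0\<^sub>m 1 k) (0\<^sub>m k 1) (mat_adjoint P)"
    using P n
    by (intro eq_matI) (auto simp: Q_def)
  have Q': "mat_adjoint Q \<in> carrier_mat n n" using Q by simp
  have QQ: "mat_adjoint Q * Q = 1\<^sub>m n"
    unfolding Q'eq unfolding Q_def using P P' n
    by (subst mult_four_block_mat[of _ 1 1 _ k _ k _ _ 1 _ k]) auto
  have QBQ: "mat_adjoint Q * B * Q = mat n n (\<lambda>(i, j). if i = j then (e # es) ! i else 0)"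
  proof -
    have "mat_adjoint Q * B = four_block_mat (mat 1 1 (\<lambda>_. e)) (0\<^sub>m 1 k) (0\<^sub>m k 1) (mat_adjoint P * C)"
      unfolding Q'eq BC using P P' C
      by (subst mult_four_block_mat[of _ 1 1 _ k _ k _ _ 1 _ k]) (auto intro!: cong_four_block_mat)
    moreover have "\<dots> * Q = four_block_mat (mat 1 1 (\<lambda>_. e)) (0\<^sub>m 1 k) (0\<^sub>m k 1) (mat_adjoint P * C * P)"
      unfolding Q_def using P P' C
      by (subst mult_four_block_mat[of _ 1 1 _ k _ k _ _ 1 _ k]) (auto intro!: cong_four_block_mat)
    ultimately show ?thesis using n by (auto intro!: eq_matI simp: PC nth_Cons')
  qed
  have "mat_adjoint W * (W * Q) = Q"
    using assoc_mult_mat[OF W' W(1) Q] W(2) Q by simp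
  then have 1: "mat_adjoint (W * Q) * (W * Q) = 1\<^sub>m n"
    using W W' Q Q' QQ by (simp add: mat_adjoint_mult assoc_mult_mat[of _ n n _ n _ n])
  have "mat_adjoint (W * Q) * A * (W * Q) = mat_adjoint Q * B * Q"
    using W W' Q Q' A
    by (simp add: B_def mat_adjoint_mult assoc_mult_mat[of _ n n _ n _ n] del: mat_adjoint_carrier)
  with 1 show ?case using QBQ W Q by (intro bexI[of _ "W * Q"]) auto
qed

section \<open>Singular value decomposition\<close>

text \<open>Only the vectors \<open>V p\<close> with \<open>s ! p \<noteq> 0\<close> are unit vectors, the others are zero. This spares
  the completion of the right singular vectors to an orthonormal family.\<close>

definition singular_decomposition ::
  "nat \<Rightarrow> nat \<Rightarrow> real list \<Rightarrow> (nat \<Rightarrow> nat \<Rightarrow> complex) \<Rightarrow> (nat \<Rightarrow> nat \<Rightarrow> complex) \<Rightarrow> complex mat \<Rightarrow> bool" where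
  "singular_decomposition m n s U V A \<longleftrightarrow>
     A \<in> carrier_mat m n \<and> length s = m \<and> sorted_wrt (\<ge>) s \<and> (\<forall>x \<in> set s. 0 \<le> x) \<and>
     (\<forall>p<m. \<forall>q<m. (\<Sum>i<m. cnj (U p i) * U q i) = of_bool (p = q)) \<and>
     (\<forall>p<m. \<forall>q<m. (\<Sum>j<n. cnj (V p j) * V q j) = of_bool (p = q \<and> s ! p \<noteq> 0)) \<and>
     (\<forall>i<m. \<forall>j<n. A $$ (i, j) = (\<Sum>p<m. complex_of_real (s ! p) * U p i * cnj (V p j)))"

section \<open>Uniqueness and existence of the decomposition\<close>

lemma proots_linear_factors:
  "proots (\<Prod>z\<leftarrow>zs. [:-z, 1:]) = mset (zs :: complex list)"
proof (induction zs)
  case (Cons z zs)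
  have "(\<Prod>z\<leftarrow>zs. [:-z, 1:]) \<noteq> 0" by (auto simp: prod_list_zero_iff)
  then show ?case using Cons by (simp add: proots_mult del: mult_pCons_left)
qed simp

lemma singular_values_char_poly:
  assumes "char_poly (A * mat_adjoint A) = (\<Prod>z\<leftarrow>zs. [:-z, 1:])"
  shows "singular_values A = rev (sort (map (\<lambda>z. sqrt (Re z)) zs))"
  by (simp add: singular_values_def assms proots_linear_factors flip: mset_map)

text \<open>Lets a conjugate of \<open>A A\<^sup>*\<close> be read as the table of inner products of
  the rows of \<open>mat_adjoint U * A\<close>: its diagonal holds squared lengths, and if it is
  diagonal, the rows are orthogonal.\<close>

lemma gram_unitary_conjugate:
  fixes A U :: "complex mat"
  assumes A: "A \<in> carrier_mat m n" and U: "U \<in> carrier_mat m m"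
  shows "mat_adjoint U * (A * mat_adjoint A) * U = (mat_adjoint U * A) * mat_adjoint (mat_adjoint U * A)"
proof -
  have "mat_adjoint (mat_adjoint U * A) = mat_adjoint A * U"
    using A U by (simp add: mat_adjoint_mult)
  moreover have "mat_adjoint U * (A * mat_adjoint A) = (mat_adjoint U * A) * mat_adjoint A"
    using A U by (intro assoc_mult_mat[symmetric, of _ m m _ n _ m]) auto
  moreover have "(mat_adjoint U * A) * mat_adjoint A * U = (mat_adjoint U * A) * (mat_adjoint A * U)"
    using A U by (intro assoc_mult_mat[of _ m n _ m _ m]) auto
  ultimately show ?thesis by simp
qed

lemma gram_index:
  fixes G :: "complex mat"
  assumes "G \<in> carrier_mat m n" "p < m" "q < m"
  shows "(G * mat_adjoint G) $$ (p, q) = (\<Sum>j<n. G $$ (p, j) * cnj (G $$ (q, j)))"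
  using assms by (simp add: scalar_prod_def atLeast0LessThan)

text \<open>In the basis of left vectors the rows of \<open>A\<close> become \<open>s ! p\<close>
  times the conjugate of \<open>V p\<close>, and these are pairwise orthogonal. So
  \<open>A A\<^sup>*\<close> is unitarily similar to the diagonal matrix of the squares of
  \<open>s\<close>, and its characteristic polynomial determines \<open>s\<close>.\<close>

lemma singular_values_eqI:
  assumes "singular_decomposition m n s U V A"
  shows "singular_values A = s"
proof -
  have A: "A \<in> carrier_mat m n" and len: "length s = m" and s: "sorted_wrt (\<ge>) s" "\<forall>x \<in> set s. 0 \<le> x"
    and Uo: "\<And>p q. p < m \<Longrightarrow> q < m \<Longrightarrow> (\<Sum>i<m. cnj (U p i) * U q i) = of_bool (p = q)"
    and Vo: "\<And>p q. p < m \<Longrightarrow> q < m \<Longrightarrow> (\<Sum>j<n. cnj (V p j) * V q j) = of_bool (p = q \<and> s ! p \<noteq> 0)"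
    and Aij: "\<And>i j. i < m \<Longrightarrow> j < n \<Longrightarrow> A $$ (i, j) = (\<Sum>p<m. complex_of_real (s ! p) * U p i * cnj (V p j))"
    using assms unfolding singular_decomposition_def by blast+
  define W where "W = mat m m (\<lambda>(i, p). U p i)"
  have W: "W \<in> carrier_mat m m" by (simp add: W_def)
  have WW: "mat_adjoint W * W = 1\<^sub>m m"
    using W by (intro eq_matI) (auto simp: W_def scalar_prod_def atLeast0LessThan Uo)
  define G where "G = mat_adjoint W * A"
  have G: "G \<in> carrier_mat m n" using W A by (auto simp: G_def)
  have Gpj: "G $$ (p, j) = complex_of_real (s ! p) * cnj (V p j)" if "p < m" "j < n" for p j
  proof -
    have "G $$ (p, j) = (\<Sum>i<m. cnj (U p i) * (\<Sum>q<m. complex_of_real (s ! q) * U q i * cnj (V q j)))"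
      using that A by (simp add: G_def W_def scalar_prod_def atLeast0LessThan Aij)
    also have "\<dots> = (\<Sum>q<m. complex_of_real (s ! q) * cnj (V q j) * (\<Sum>i<m. cnj (U p i) * U q i))"
      unfolding sum_distrib_left by (subst sum.swap) (simp add: mult_ac)
    also have "\<dots> = (\<Sum>q<m. if q = p then complex_of_real (s ! p) * cnj (V p j) else 0)"
      using that by (intro sum.cong) (auto simp: Uo)
    finally show ?thesis using that by simp
  qed
  define D where "D = G * mat_adjoint G"
  have D: "D \<in> carrier_mat m m" using G by (simp add: D_def)
  have Dpq: "D $$ (p, q) = (if p = q then complex_of_real ((s ! p)\<^sup>2) else 0)" if "p < m" "q < m" for p q
  proof -
    have "D $$ (p, q) = (\<Sum>j<n. complex_of_real (s ! p * s ! q) * (cnj (V p j) * V q j))"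
      unfolding D_def gram_index[OF G that] using that by (simp add: Gpj mult_ac)
    also have "\<dots> = complex_of_real (s ! p * s ! q) * of_bool (p = q \<and> s ! p \<noteq> 0)"
      using that by (simp add: Vo flip: sum_distrib_left)
    finally show ?thesis by (auto simp: power2_eq_square)
  qed
  have "char_poly (A * mat_adjoint A) = char_poly D"
    using char_poly_unitary_conjugate[OF _ W WW, of "A * mat_adjoint A"] A
    by (simp add: gram_unitary_conjugate[OF A W] D_def G_def)
  also have "\<dots> = (\<Prod>z\<leftarrow>diag_mat D. [:-z, 1:])"
    by (rule char_poly_upper_triangular[OF D]) (use D in \<open>auto simp: Dpq\<close>)
  also have "diag_mat D = map (\<lambda>x. complex_of_real (x\<^sup>2)) s"
    using D len by (intro nth_equalityI) (auto simp: diag_mat_def Dpq)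
  finally have "singular_values A = rev (sort (map (\<lambda>z. sqrt (Re z)) (map (\<lambda>x. complex_of_real (x\<^sup>2)) s)))"
    by (rule singular_values_char_poly)
  also have "map (\<lambda>z. sqrt (Re z)) (map (\<lambda>x. complex_of_real (x\<^sup>2)) s) = s"
    using s(2) by (auto intro!: map_idI)
  also have "sort s = rev s"
    using s(1) by (intro properties_for_sort) (auto simp: sorted_wrt_rev)
  finally show ?thesis by simp
qed

text \<open>\<open>A A\<^sup>*\<close> is diagonalized twice: first to see that its eigenvalues are
  nonnegative reals, hence squares of their roots, then with the eigenvalues in decreasing order.
  The columns of the second \<open>U\<close> are the left vectors; the nonzero rows of
  \<open>mat_adjoint U * A\<close>, conjugated and scaled to length 1, are the right ones.\<close>

lemma singular_decomposition_exists:
  assumes A: "A \<in> carrier_mat m n"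
  shows "\<exists>U V. singular_decomposition m n (singular_values A) U V A"
proof -
  define H where "H = A * mat_adjoint A"
  have H: "H \<in> carrier_mat m m" "mat_adjoint H = H" using A by (auto simp: H_def mat_adjoint_mult)
  obtain zs where zs: "char_poly H = (\<Prod>z\<leftarrow>zs. [:-z, 1:])" "length zs = m"
    using char_poly_factorized[OF H(1)] by auto
  define t where "t = map (\<lambda>z. sqrt (Re z)) zs"
  define s where "s = singular_values A"
  have s: "s = rev (sort t)"
    using singular_values_char_poly[OF zs(1)[unfolded H_def]] by (simp add: s_def t_def)
  have zs_eq: "zs = map (\<lambda>x. complex_of_real (x\<^sup>2)) t" and t0: "\<forall>x \<in> set t. 0 \<le> x"
  proof -
    obtain U where U: "U \<in> carrier_mat m m"
      and UHU: "mat_adjoint U * H * U = mat m m (\<lambda>(i, j). if i = j then zs ! i else 0)"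
      using hermitian_unitary_diagonalization[OF H zs(1)] by blast
    have G: "mat_adjoint U * A \<in> carrier_mat m n" using A U by auto
    \<comment> \<open>Each eigenvalue is the squared length of a row of
      \<open>mat_adjoint U * A\<close>.\<close>
    have "\<exists>r\<ge>0. zs ! p = complex_of_real r" if "p < m" for p
    proof -
      have "zs ! p = (mat_adjoint U * H * U) $$ (p, p)" using that by (simp add: UHU)
      also have "\<dots> = (\<Sum>j<n. complex_of_real ((cmod ((mat_adjoint U * A) $$ (p, j)))\<^sup>2))"
        unfolding H_def gram_unitary_conjugate[OF A U] gram_index[OF G that that]
        by (simp only: complex_norm_square)
      finally show ?thesis by (intro exI[of _ "\<Sum>j<n. (cmod ((mat_adjoint U * A) $$ (p, j)))\<^sup>2"])
          (auto intro: sum_nonneg)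
    qed
    then have *: "\<forall>z \<in> set zs. \<exists>r\<ge>0. z = complex_of_real r" using zs(2) by (auto simp: in_set_conv_nth)
    then show "zs = map (\<lambda>x. complex_of_real (x\<^sup>2)) t"
      unfolding t_def map_map by (intro map_idI[symmetric]) (auto dest!: bspec simp flip: of_real_power)
    from * show "\<forall>x \<in> set t. 0 \<le> x" unfolding t_def by auto
  qed
  have st: "mset s = mset t" by (simp add: s)
  \<comment> \<open>The linear factors commute, so they may be listed in the order of
    \<open>s\<close>, which the new diagonal then follows.\<close>
  have "char_poly H = prod_mset (image_mset (\<lambda>x. [:- complex_of_real (x\<^sup>2), 1:]) (mset s))"
    unfolding zs(1) zs_eq st by (simp add: prod_mset_prod_list o_def flip: mset_map)
  also have "\<dots> = (\<Prod>z\<leftarrow>map (\<lambda>x. complex_of_real (x\<^sup>2)) s. [:-z, 1:])"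
    by (simp add: prod_mset_prod_list o_def flip: mset_map)
  finally obtain U where U: "U \<in> carrier_mat m m" "mat_adjoint U * U = 1\<^sub>m m"
    and UHU: "mat_adjoint U * H * U =
      mat m m (\<lambda>(i, j). if i = j then map (\<lambda>x. complex_of_real (x\<^sup>2)) s ! i else 0)"
    using hermitian_unitary_diagonalization[OF H] by blast
  have len: "length s = m" by (simp add: s t_def zs(2))
  define G where "G = mat_adjoint U * A"
  have G: "G \<in> carrier_mat m n" using A U by (auto simp: G_def)
  have GG: "(\<Sum>j<n. G $$ (p, j) * cnj (G $$ (q, j))) = (if p = q then complex_of_real ((s ! p)\<^sup>2) else 0)"
    if "p < m" "q < m" for p q
    using that len unfolding gram_index[OF G that, symmetric]
    by (simp add: G_def gram_unitary_conjugate[OF A U(1), symmetric] UHU[unfolded H_def])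
  \<comment> \<open>A row of length 0 vanishes, so \<open>A\<close> can be recovered although
    \<open>V\<close> does not record such a row.\<close>
  have G0: "G $$ (p, j) = 0" if "p < m" "j < n" "s ! p = 0" for p j
  proof -
    have "complex_of_real (\<Sum>j<n. (cmod (G $$ (p, j)))\<^sup>2) = 0"
      using GG[of p p] that by (simp only: complex_norm_square of_real_sum) simp
    then have "(\<Sum>j<n. (cmod (G $$ (p, j)))\<^sup>2) = 0" by (simp only: of_real_eq_0_iff)
    then show ?thesis using that(2) by (subst (asm) sum_nonneg_eq_0_iff) auto
  qed
  \<comment> \<open>Division by zero yields 0, so \<open>V p\<close> is the zero vector where
    \<open>s ! p = 0\<close>, as \<open>singular_decomposition\<close> demands.\<close>
  define V where "V p j = cnj (G $$ (p, j) / complex_of_real (s ! p))" for p j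
  have "singular_decomposition m n s (\<lambda>p i. U $$ (i, p)) V A"
    unfolding singular_decomposition_def
  proof (intro conjI allI impI)
    show "sorted_wrt (\<ge>) s" by (simp add: s sorted_wrt_rev)
    show "\<forall>x\<in>set s. 0 \<le> x" using t0 by (simp add: s)
    fix p q assume pq: "p < m" "q < m"
    have "(\<Sum>i<m. cnj (U $$ (i, p)) * U $$ (i, q)) = (mat_adjoint U * U) $$ (p, q)"
      using U(1) pq by (simp add: scalar_prod_def atLeast0LessThan)
    then show "(\<Sum>i<m. cnj (U $$ (i, p)) * U $$ (i, q)) = of_bool (p = q)"
      using pq by (simp add: U(2))
    have "(\<Sum>j<n. cnj (V p j) * V q j) =
      (\<Sum>j<n. G $$ (p, j) * cnj (G $$ (q, j))) / complex_of_real (s ! p * s ! q)"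
      by (simp add: V_def sum_divide_distrib)
    then show "(\<Sum>j<n. cnj (V p j) * V q j) = of_bool (p = q \<and> s ! p \<noteq> 0)"
      using pq by (auto simp: GG power2_eq_square)
  next
    fix i j assume ij: "i < m" "j < n"
    have "A = (U * mat_adjoint U) * A" using unitary_mult_adjoint[OF U] A by simp
    also have "\<dots> = U * G" unfolding G_def using U A by (intro assoc_mult_mat[of _ m m _ m _ n]) auto
    finally have "A $$ (i, j) = (U * G) $$ (i, j)" by simp
    also have "\<dots> = (\<Sum>p<m. U $$ (i, p) * G $$ (p, j))"
      using U(1) G ij by (simp add: scalar_prod_def atLeast0LessThan)
    also have "\<dots> = (\<Sum>p<m. complex_of_real (s ! p) * U $$ (i, p) * cnj (V p j))"
      using ij by (intro sum.cong) (auto simp: V_def G0)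
    finally show "A $$ (i, j) = (\<Sum>p<m. complex_of_real (s ! p) * U $$ (i, p) * cnj (V p j))" .
  qed (use A len in auto)
  then show ?thesis unfolding s_def by blast
qed

section \<open>Duality for the Ky Fan norm\<close>

text \<open>Orthonormal up to zero vectors: \<open>P\<close> marks the unit vectors and the others
  are zero. This covers the right vectors of a \<open>singular_decomposition\<close>.\<close>

definition semi_orthonormal :: "(nat \<Rightarrow> bool) \<Rightarrow> nat \<Rightarrow> nat \<Rightarrow> (nat \<Rightarrow> nat \<Rightarrow> complex) \<Rightarrow> bool" where
  "semi_orthonormal P k m f \<longleftrightarrow>
     (\<forall>p<k. \<forall>q<k. (\<Sum>i<m. cnj (f p i) * f q i) = of_bool (p = q \<and> P p))"

lemma semi_orthonormalD:
  "semi_orthonormal P k m f \<Longrightarrow> p < k \<Longrightarrow> q < k \<Longrightarrow>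
    (\<Sum>i<m. cnj (f p i) * f q i) = of_bool (p = q \<and> P p)"
  by (simp add: semi_orthonormal_def)

lemma semi_orthonormal_norm_le_1:
  assumes "semi_orthonormal P k m f" "p < k"
  shows "(\<Sum>i<m. (cmod (f p i))\<^sup>2) \<le> 1"
proof -
  have "complex_of_real (\<Sum>i<m. (cmod (f p i))\<^sup>2) = (\<Sum>i<m. cnj (f p i) * f p i)"
    by (simp only: complex_norm_square of_real_sum mult.commute)
  also have "\<dots> = complex_of_real (of_bool (P p))" using semi_orthonormalD[OF assms assms(2)] by simp
  finally show ?thesis by (simp only: of_real_eq_iff) simp
qed

lemma of_real_of_bool [simp]: "of_real (of_bool b) = of_bool b"
  by (cases b) auto

section \<open>Bessel's inequality and its consequences for pairings\<close>

lemma sum_swap3: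
  "(\<Sum>a\<in>A. \<Sum>b\<in>B. \<Sum>c\<in>C. f a b c) = (\<Sum>c\<in>C. \<Sum>a\<in>A. \<Sum>b\<in>B. f a b c)"
  by (subst sum.swap[of _ A C]) (intro sum.cong refl sum.swap)

text \<open>Expand the squared length of \<open>x - y\<close>, where \<open>y\<close> combines the
  \<open>f p\<close> with coefficients \<open>a p\<close>. The result is the squared length of
  \<open>x\<close> minus \<open>2 S\<close> plus \<open>S'\<close>, where \<open>S\<close> sums all
  squared coefficients and \<open>S'\<close> only those with \<open>P p\<close>. Since
  \<open>S' \<le> S\<close>, nonnegativity gives the claim.\<close>

lemma bessel_inequality:
  assumes f: "semi_orthonormal P k m f"
  shows "(\<Sum>p<k. (cmod (\<Sum>i<m. cnj (f p i) * x i))\<^sup>2) \<le> (\<Sum>i<m. (cmod (x i))\<^sup>2)"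
proof -
  define a where "a p = (\<Sum>i<m. cnj (f p i) * x i)" for p
  define y where "y i = (\<Sum>p<k. a p * f p i)" for i
  have cnj_a: "cnj (a p) = (\<Sum>i<m. f p i * cnj (x i))" for p by (simp add: a_def)
  have yx: "(\<Sum>i<m. y i * cnj (x i)) = complex_of_real (\<Sum>p<k. (cmod (a p))\<^sup>2)"
  proof -
    have "(\<Sum>i<m. y i * cnj (x i)) = (\<Sum>p<k. a p * (\<Sum>i<m. f p i * cnj (x i)))"
      unfolding y_def sum_distrib_left sum_distrib_right by (subst sum.swap) (simp add: mult_ac)
    then show ?thesis by (simp only: cnj_a[symmetric] complex_norm_square of_real_sum)
  qed
  have "cnj (\<Sum>i<m. y i * cnj (x i)) = (\<Sum>i<m. x i * cnj (y i))" by (simp add: mult.commute)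
  then have xy: "(\<Sum>i<m. x i * cnj (y i)) = complex_of_real (\<Sum>p<k. (cmod (a p))\<^sup>2)"
    unfolding yx by simp
  have yy: "(\<Sum>i<m. y i * cnj (y i)) = complex_of_real (\<Sum>p<k. (cmod (a p))\<^sup>2 * of_bool (P p))"
  proof -
    have "(\<Sum>i<m. y i * cnj (y i)) = (\<Sum>i<m. \<Sum>p<k. \<Sum>q<k. a p * cnj (a q) * (cnj (f q i) * f p i))"
      by (simp add: y_def sum_product mult_ac)
    also have "\<dots> = (\<Sum>p<k. \<Sum>q<k. a p * cnj (a q) * (\<Sum>i<m. cnj (f q i) * f p i))"
      unfolding sum_distrib_left by (rule sum_swap3[symmetric])
    also have "\<dots> = (\<Sum>p<k. \<Sum>q<k. if q = p then a p * cnj (a p) * of_bool (P p) else 0)"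
      by (intro sum.cong) (auto simp: semi_orthonormalD[OF f])
    also have "\<dots> = (\<Sum>p<k. a p * cnj (a p) * of_bool (P p))" by simp
    finally show ?thesis by (simp only: complex_norm_square of_real_sum of_real_mult) simp
  qed
  have "complex_of_real (\<Sum>i<m. (cmod (x i - y i))\<^sup>2) =
    (\<Sum>i<m. x i * cnj (x i) - x i * cnj (y i) - y i * cnj (x i) + y i * cnj (y i))"
    by (simp only: complex_norm_square of_real_sum) (simp add: algebra_simps)
  also have "\<dots> = complex_of_real ((\<Sum>i<m. (cmod (x i))\<^sup>2) - 2 * (\<Sum>p<k. (cmod (a p))\<^sup>2)
      + (\<Sum>p<k. (cmod (a p))\<^sup>2 * of_bool (P p)))"
    unfolding sum.distrib sum_subtractf yx xy yy
    by (simp only: complex_norm_square of_real_sum of_real_add of_real_diff of_real_mult) simp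
  finally have "(\<Sum>i<m. (cmod (x i - y i))\<^sup>2) = (\<Sum>i<m. (cmod (x i))\<^sup>2) - 2 * (\<Sum>p<k. (cmod (a p))\<^sup>2)
      + (\<Sum>p<k. (cmod (a p))\<^sup>2 * of_bool (P p))" by (simp only: of_real_eq_iff)
  moreover have "0 \<le> (\<Sum>i<m. (cmod (x i - y i))\<^sup>2)" by (intro sum_nonneg) auto
  moreover have "(\<Sum>p<k. (cmod (a p))\<^sup>2 * of_bool (P p)) \<le> (\<Sum>p<k. (cmod (a p))\<^sup>2)"
    by (intro sum_mono) auto
  ultimately show ?thesis unfolding a_def by linarith
qed

text \<open>The arithmetic-geometric mean inequality stands in for Cauchy-Schwarz; nothing is lost
  where both square sums have the same bound.\<close>

lemma cmod_sum_mult_le: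
  "cmod (\<Sum>p<k. a p * b p) \<le> ((\<Sum>p<k. (cmod (a p))\<^sup>2) + (\<Sum>p<k. (cmod (b p))\<^sup>2)) / 2"
proof -
  have "cmod (a p * b p) \<le> ((cmod (a p))\<^sup>2 + (cmod (b p))\<^sup>2) / 2" for p
    using sum_squares_bound[of "cmod (a p)" "cmod (b p)"] by (simp add: norm_mult)
  then have "cmod (\<Sum>p<k. a p * b p) \<le> (\<Sum>p<k. ((cmod (a p))\<^sup>2 + (cmod (b p))\<^sup>2) / 2)"
    by (rule sum_norm_le)
  then show ?thesis by (simp add: sum.distrib flip: sum_divide_distrib)
qed

text \<open>For unit vectors \<open>x\<close> and \<open>y\<close> the bound is 1: the matrix
  \<open>\<Sum>\<^sub>p u\<^sub>p v\<^sub>p\<^sup>*\<close> is a contraction.\<close>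

lemma bessel_pairing_bound:
  assumes U: "semi_orthonormal P k m U" and V: "semi_orthonormal Q k n V"
  shows "cmod (\<Sum>p<k. (\<Sum>i<m. cnj (U p i) * x i) * (\<Sum>j<n. V p j * cnj (y j)))
    \<le> ((\<Sum>i<m. (cmod (x i))\<^sup>2) + (\<Sum>j<n. (cmod (y j))\<^sup>2)) / 2"
proof -
  have "cmod (\<Sum>j<n. V p j * cnj (y j)) = cmod (\<Sum>j<n. cnj (V p j) * y j)" for p
    using complex_mod_cnj[of "\<Sum>j<n. V p j * cnj (y j)"] by simp
  then show ?thesis
    using cmod_sum_mult_le[of "\<lambda>p. \<Sum>i<m. cnj (U p i) * x i" "\<lambda>p. \<Sum>j<n. V p j * cnj (y j)" k]
      bessel_inequality[OF U, of x] bessel_inequality[OF V, of y] by simp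
qed

section \<open>Partial isometries and their Frobenius pairings\<close>

definition partial_isometry ::
  "nat \<Rightarrow> (nat \<Rightarrow> nat \<Rightarrow> complex) \<Rightarrow> (nat \<Rightarrow> nat \<Rightarrow> complex) \<Rightarrow> nat \<Rightarrow> nat \<Rightarrow> complex" where
  "partial_isometry k U V i j = (\<Sum>p<k. U p i * cnj (V p j))"

text \<open>An interchange of finite sums that reduces the pairing with a sum of rank-one terms to
  inner products of vectors. It serves for a singular value decomposition, for the partial isometry
  itself and for the all-ones matrix.\<close>

lemma partial_isometry_pairing:
  "(\<Sum>i<m. \<Sum>j<n. cnj (partial_isometry k U V i j) * (\<Sum>q<l. c q * X q i * cnj (Y q j))) =
    (\<Sum>q<l. c q * (\<Sum>p<k. (\<Sum>i<m. cnj (U p i) * X q i) * (\<Sum>j<n. V p j * cnj (Y q j))))"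
proof -
  let ?f = "\<lambda>i j p q. c q * ((cnj (U p i) * X q i) * (V p j * cnj (Y q j)))"
  have "(\<Sum>i<m. \<Sum>j<n. cnj (partial_isometry k U V i j) * (\<Sum>q<l. c q * X q i * cnj (Y q j))) =
    (\<Sum>i<m. \<Sum>j<n. \<Sum>p<k. \<Sum>q<l. ?f i j p q)"
    unfolding partial_isometry_def cnj_sum sum_product by (simp add: mult_ac)
  also have "\<dots> = (\<Sum>p<k. \<Sum>i<m. \<Sum>j<n. \<Sum>q<l. ?f i j p q)" by (rule sum_swap3)
  also have "\<dots> = (\<Sum>p<k. \<Sum>q<l. \<Sum>i<m. \<Sum>j<n. ?f i j p q)"
    by (intro sum.cong refl sum_swap3)
  also have "\<dots> = (\<Sum>q<l. \<Sum>p<k. \<Sum>i<m. \<Sum>j<n. ?f i j p q)" by (rule sum.swap)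
  also have "\<dots> = (\<Sum>q<l. c q * (\<Sum>p<k. (\<Sum>i<m. cnj (U p i) * X q i) * (\<Sum>j<n. V p j * cnj (Y q j))))"
    by (simp add: sum_product flip: sum_distrib_left)
  finally show ?thesis .
qed

text \<open>Paired with itself, the matrix keeps only the terms \<open>p = q\<close>, and such a
  term counts 1 exactly if both vectors are nonzero.\<close>

lemma partial_isometry_norm:
  assumes U: "semi_orthonormal P k m U" and V: "semi_orthonormal Q k n V"
  shows "(\<Sum>i<m. \<Sum>j<n. (cmod (partial_isometry k U V i j))\<^sup>2) = (\<Sum>p<k. of_bool (P p \<and> Q p))"
proof -
  have *: "(\<Sum>j<n. V p j * cnj (V q j)) = of_bool (p = q \<and> Q p)" if "p < k" "q < k" for p q
    using semi_orthonormalD[OF V that(2,1)] that by (auto simp: mult.commute)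
  have "complex_of_real (\<Sum>i<m. \<Sum>j<n. (cmod (partial_isometry k U V i j))\<^sup>2) =
    (\<Sum>i<m. \<Sum>j<n. cnj (partial_isometry k U V i j) * (\<Sum>q<k. 1 * U q i * cnj (V q j)))"
    by (simp only: complex_norm_square of_real_sum) (simp add: partial_isometry_def mult.commute)
  also have "\<dots> = (\<Sum>q<k. \<Sum>p<k. if p = q then of_bool (P p \<and> Q p) else 0)"
    unfolding partial_isometry_pairing unfolding mult_1
    by (intro sum.cong refl) (auto simp: semi_orthonormalD[OF U] *)
  also have "\<dots> = (\<Sum>q<k. of_bool (P q \<and> Q q))"
    by (intro sum.cong refl) (subst sum.delta; simp)
  also have "\<dots> = complex_of_real (\<Sum>p<k. of_bool (P p \<and> Q p))" by (simp del: sum_of_bool_eq)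
  finally show ?thesis by (simp only: of_real_eq_iff)
qed

text \<open>The all-ones vectors, scaled to length 1, form a rank-one matrix to which the
  contraction bound 1 applies.\<close>

lemma partial_isometry_sum_le:
  assumes U: "semi_orthonormal P k m U" and V: "semi_orthonormal Q k n V" and mn: "0 < m" "0 < n"
  shows "(\<Sum>i<m. \<Sum>j<n. Re (partial_isometry k U V i j)) \<le> sqrt (real m * real n)"
proof -
  define x y where "x = complex_of_real (1 / sqrt m)" and "y = complex_of_real (1 / sqrt n)"
  \<comment> \<open>The sum over a single index \<open>q\<close> brings this rank-one matrix into
    the form of \<open>partial_isometry_pairing\<close>.\<close>
  have "(\<Sum>i<m. \<Sum>j<n. cnj (partial_isometry k U V i j) * (\<Sum>q<1::nat. 1 * x * cnj y)) =
    (\<Sum>i<m. \<Sum>j<n. cnj (partial_isometry k U V i j)) * complex_of_real (1 / sqrt (real m * real n))"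
    by (simp add: x_def y_def real_sqrt_mult sum_divide_distrib)
  then have "cmod ((\<Sum>i<m. \<Sum>j<n. cnj (partial_isometry k U V i j)) * complex_of_real (1 / sqrt (real m * real n)))
    \<le> ((\<Sum>i<m. (cmod x)\<^sup>2) + (\<Sum>j<n. (cmod y)\<^sup>2)) / 2"
    unfolding partial_isometry_pairing[where X = "\<lambda>_ _. x" and Y = "\<lambda>_ _. y"]
    using bessel_pairing_bound[OF U V, of "\<lambda>_. x" "\<lambda>_. y"] by simp
  also have "\<dots> = 1" using mn by (simp add: x_def y_def norm_divide power_divide)
  finally have "cmod (\<Sum>i<m. \<Sum>j<n. cnj (partial_isometry k U V i j)) \<le> sqrt (real m * real n)"
    using mn by (simp add: norm_mult norm_divide field_simps)
  moreover have "Re (\<Sum>i<m. \<Sum>j<n. cnj (partial_isometry k U V i j)) = (\<Sum>i<m. \<Sum>j<n. Re (partial_isometry k U V i j))"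
    by simp
  ultimately show ?thesis using complex_Re_le_cmod order_trans by metis
qed

text \<open>Use the \<open>k\<close>-th entry \<open>r\<close> as a threshold. Replacing the weights
  by 1 on the first \<open>k\<close> positions and by 0 afterwards does not decrease the sum of
  \<open>(s ! q - r) * t q\<close>, and \<open>r\<close> times the total weight is at most
  \<open>r * k\<close>.\<close>

lemma sum_weighted_decreasing_le:
  fixes s :: "real list" and t :: "nat \<Rightarrow> real"
  assumes s: "sorted_wrt (\<ge>) s" "\<forall>x \<in> set s. 0 \<le> x" "length s = m" and k: "k \<le> m" "1 \<le> k"
    and t: "\<And>q. q < m \<Longrightarrow> 0 \<le> t q" "\<And>q. q < m \<Longrightarrow> t q \<le> 1" "(\<Sum>q<m. t q) \<le> real k"
  shows "(\<Sum>q<m. s ! q * t q) \<le> (\<Sum>q<k. s ! q)"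
proof -
  define r where "r = s ! (k - 1)"
  have r: "0 \<le> r" using s k by (simp add: r_def)
  have ge: "s ! q \<ge> r" if "q < k" for q
    using sorted_wrt_nth_less[OF s(1), of q "k - 1"] that s(3) k
    by (cases "q = k - 1") (auto simp: r_def)
  have le: "s ! q \<le> r" if "k \<le> q" "q < m" for q
    using sorted_wrt_nth_less[OF s(1), of "k - 1" q] that s(3) k by (auto simp: r_def)
  have "(\<Sum>q<m. (s ! q - r) * t q) \<le> (\<Sum>q<m. if q < k then s ! q - r else 0)"
  proof (rule sum_mono)
    fix q assume "q \<in> {..<m}"
    then show "(s ! q - r) * t q \<le> (if q < k then s ! q - r else 0)"
      using ge[of q] le[of q] t(1,2)[of q]
        mult_left_le[of "t q" "s ! q - r"] mult_nonpos_nonneg[of "s ! q - r" "t q"] by auto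
  qed
  also have "\<dots> = (\<Sum>q<k. s ! q - r)"
    using k by (intro sum.mono_neutral_cong_right) auto
  finally have "(\<Sum>q<m. (s ! q - r) * t q) + r * (\<Sum>q<m. t q) \<le> (\<Sum>q<k. s ! q - r) + r * real k"
    using mult_left_mono[OF t(3) r] by linarith
  then show ?thesis by (simp add: algebra_simps sum_subtractf sum_distrib_left)
qed

section \<open>The Ky Fan norm as a maximum of pairings\<close>

lemma ky_fan_norm_eq_sum:
  assumes "singular_decomposition m n s U V A"
  shows "ky_fan_norm k A = (\<Sum>p<k. s ! p)"
  unfolding ky_fan_norm_def singular_value_def singular_values_eqI[OF assms]
  by (simp add: sum.atLeast1_atMost_eq)

lemma singular_decomposition_orthonormal:
  assumes "singular_decomposition m n s U V A" "k \<le> m"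
  shows "semi_orthonormal (\<lambda>_. True) k m U" "semi_orthonormal (\<lambda>p. s ! p \<noteq> 0) k n V"
  using assms by (auto simp: singular_decomposition_def semi_orthonormal_def)

text \<open>Orthonormality leaves only the terms \<open>p = q\<close> with \<open>q < k\<close>.
  Where \<open>s ! q = 0\<close> the right vector is zero, but so is the weight.\<close>

lemma ky_fan_norm_attained:
  assumes A: "singular_decomposition m n s U V A" and k: "k \<le> m"
  shows "(\<Sum>i<m. \<Sum>j<n. cnj (partial_isometry k U V i j) * A $$ (i, j)) = complex_of_real (ky_fan_norm k A)"
proof -
  note UV = singular_decomposition_orthonormal[OF A order_refl]
  have *: "(\<Sum>j<n. V p j * cnj (V q j)) = of_bool (p = q \<and> s ! p \<noteq> 0)" if "p < m" "q < m" for p q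
    using semi_orthonormalD[OF UV(2) that(2,1)] that by (auto simp: mult.commute)
  have "(\<Sum>i<m. \<Sum>j<n. cnj (partial_isometry k U V i j) * A $$ (i, j)) =
    (\<Sum>i<m. \<Sum>j<n. cnj (partial_isometry k U V i j) * (\<Sum>q<m. complex_of_real (s ! q) * U q i * cnj (V q j)))"
    using A by (simp add: singular_decomposition_def)
  also have "\<dots> = (\<Sum>q<m. complex_of_real (s ! q) * (\<Sum>p<k. if p = q then of_bool (s ! q \<noteq> 0) else 0))"
    unfolding partial_isometry_pairing using k
    by (intro sum.cong arg_cong2[where f = "(*)"] refl) (auto simp: semi_orthonormalD[OF UV(1)] *)
  also have "\<dots> = (\<Sum>q<m. if q < k then complex_of_real (s ! q) else 0)" by (intro sum.cong) auto
  also have "\<dots> = (\<Sum>q<k. complex_of_real (s ! q))"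
    using k by (intro sum.mono_neutral_cong_right) auto
  finally show ?thesis by (simp add: ky_fan_norm_eq_sum[OF A])
qed

text \<open>A singular value decomposition of \<open>A\<close> turns the pairing into a weighted sum
  of singular values. Bessel's inequality bounds each weight by 1 and their total by
  \<open>k\<close>, which is what \<open>sum_weighted_decreasing_le\<close> asks for.\<close>

lemma ky_fan_norm_dual_bound:
  assumes A: "A \<in> carrier_mat m n" and k: "1 \<le> k" "k \<le> m"
    and U: "semi_orthonormal P k m U" and V: "semi_orthonormal Q k n V"
  shows "Re (\<Sum>i<m. \<Sum>j<n. cnj (partial_isometry k U V i j) * A $$ (i, j)) \<le> ky_fan_norm k A"
proof -
  obtain X Y where XY: "singular_decomposition m n (singular_values A) X Y A"
    using singular_decomposition_exists[OF A] by blast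
  define s where "s = singular_values A"
  note o = singular_decomposition_orthonormal[OF XY order_refl]
  define t where "t q = (\<Sum>p<k. (\<Sum>i<m. cnj (U p i) * X q i) * (\<Sum>j<n. V p j * cnj (Y q j)))" for q
  \<comment> \<open>Bessel for the families \<open>U\<close> and \<open>V\<close>, applied to the
    vectors \<open>X q\<close> and \<open>Y q\<close>.\<close>
  have t1: "cmod (t q) \<le> 1" if "q < m" for q
    unfolding t_def
    using semi_orthonormal_norm_le_1[OF o(1) that] semi_orthonormal_norm_le_1[OF o(2) that]
    by (intro order_trans[OF bessel_pairing_bound[OF U V]]) simp
  \<comment> \<open>The roles are exchanged: after summing over \<open>q\<close> first,
    \<open>U p\<close> and \<open>V p\<close> are expanded in the families \<open>X\<close> and
    \<open>Y\<close>.\<close>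
  have tk: "(\<Sum>q<m. cmod (t q)) \<le> real k"
  proof -
    have "(\<Sum>q<m. cmod (t q)) \<le>
      (\<Sum>q<m. ((\<Sum>p<k. (cmod (\<Sum>i<m. cnj (U p i) * X q i))\<^sup>2) + (\<Sum>p<k. (cmod (\<Sum>j<n. V p j * cnj (Y q j)))\<^sup>2)) / 2)"
      unfolding t_def by (intro sum_mono cmod_sum_mult_le)
    also have "\<dots> = (\<Sum>p<k. ((\<Sum>q<m. (cmod (\<Sum>i<m. cnj (U p i) * X q i))\<^sup>2) + (\<Sum>q<m. (cmod (\<Sum>j<n. V p j * cnj (Y q j)))\<^sup>2)) / 2)"
      unfolding sum.distrib sum_divide_distrib[symmetric]
      by (subst (1 2) sum.swap) (rule refl)
    also have "\<dots> \<le> (\<Sum>p<k. 1)"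
    proof (rule sum_mono)
      fix p assume "p \<in> {..<k}"
      then have p: "p < k" by simp
      have 1: "cmod (\<Sum>i<m. cnj (U p i) * X q i) = cmod (\<Sum>i<m. cnj (X q i) * U p i)" for q
        using complex_mod_cnj[of "\<Sum>i<m. cnj (U p i) * X q i"] by (simp add: mult.commute)
      have 2: "(\<Sum>j<n. V p j * cnj (Y q j)) = (\<Sum>j<n. cnj (Y q j) * V p j)" for q
        by (simp add: mult.commute)
      show "((\<Sum>q<m. (cmod (\<Sum>i<m. cnj (U p i) * X q i))\<^sup>2) + (\<Sum>q<m. (cmod (\<Sum>j<n. V p j * cnj (Y q j)))\<^sup>2)) / 2 \<le> 1"
        using order_trans[OF bessel_inequality[OF o(1)] semi_orthonormal_norm_le_1[OF U p]]
          order_trans[OF bessel_inequality[OF o(2)] semi_orthonormal_norm_le_1[OF V p]]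
        unfolding 1 2 by simp
    qed
    finally show ?thesis by simp
  qed
  have s: "sorted_wrt (\<ge>) s" "\<forall>x \<in> set s. 0 \<le> x" "length s = m"
    using XY by (auto simp: singular_decomposition_def s_def)
  have "(\<Sum>i<m. \<Sum>j<n. cnj (partial_isometry k U V i j) * A $$ (i, j)) =
    (\<Sum>i<m. \<Sum>j<n. cnj (partial_isometry k U V i j) * (\<Sum>q<m. complex_of_real (s ! q) * X q i * cnj (Y q j)))"
    using XY by (simp add: singular_decomposition_def s_def)
  also have "\<dots> = (\<Sum>q<m. complex_of_real (s ! q) * t q)"
    unfolding partial_isometry_pairing t_def ..
  finally have "Re (\<Sum>i<m. \<Sum>j<n. cnj (partial_isometry k U V i j) * A $$ (i, j)) = (\<Sum>q<m. s ! q * Re (t q))"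
    by simp
  also have "\<dots> \<le> (\<Sum>q<m. s ! q * cmod (t q))"
    using s by (intro sum_mono mult_left_mono complex_Re_le_cmod) auto
  also have "\<dots> \<le> (\<Sum>q<k. s ! q)"
    by (rule sum_weighted_decreasing_le[OF s k(2,1)]) (use t1 tk in auto)
  finally show ?thesis by (simp add: ky_fan_norm_eq_sum[OF XY] s_def)
qed

section \<open>The centred matrix\<close>

lemma double_sum_nonneg_eq_0D:
  fixes f :: "nat \<Rightarrow> nat \<Rightarrow> real"
  assumes "(\<Sum>i<m. \<Sum>j<n. f i j) = 0" "\<And>i j. i < m \<Longrightarrow> j < n \<Longrightarrow> 0 \<le> f i j" "i < m" "j < n"
  shows "f i j = 0"
proof -
  have "(\<Sum>j<n. f i j) = 0"
    using assms by (subst (asm) sum_nonneg_eq_0_iff) (auto intro: sum_nonneg)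
  then show ?thesis using assms by (subst (asm) sum_nonneg_eq_0_iff) auto
qed

lemma cmod_le_max_norm:
  assumes "A \<in> carrier_mat m n" "i < m" "j < n"
  shows "cmod (A $$ (i, j)) \<le> max_norm A"
  unfolding max_norm_def
  using imageI[OF elements_matI[OF assms refl]] by (intro Max_ge) (auto simp: elements_mat_def)

lemma max_norm_attained:
  assumes "A \<in> carrier_mat m n" "0 < m" "0 < n"
  obtains i j where "i < m" "j < n" "max_norm A = cmod (A $$ (i, j))"
proof -
  have "A $$ (0, 0) \<in> elements_mat A" using assms by auto
  then have "max_norm A \<in> cmod ` elements_mat A"
    unfolding max_norm_def by (intro Max_in) (auto simp: elements_mat_def)
  then show ?thesis using assms(1) that by (auto dest!: elements_matD)
qed

text \<open>\<open>b\<close> holds the entries of \<open>2A - M J\<close>. Nonnegativity of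
  \<open>A\<close> enters through the bounds on \<open>b\<close>, and \<open>M\<close> is to be
  instantiated by the largest entry of \<open>A\<close>.\<close>

locale centred_nonneg_matrix =
  fixes A :: "complex mat" and m n k :: nat and b :: "nat \<Rightarrow> nat \<Rightarrow> real" and M :: real
  assumes A: "A \<in> carrier_mat m n" and m: "0 < m" and n: "0 < n" and k: "1 \<le> k" "k \<le> m"
    and entry: "\<And>i j. i < m \<Longrightarrow> j < n \<Longrightarrow> A $$ (i, j) = complex_of_real ((b i j + M) / 2)"
    and b_bound: "\<And>i j. i < m \<Longrightarrow> j < n \<Longrightarrow> \<bar>b i j\<bar> \<le> M"
begin

text \<open>The common value of the nonzero singular values of \<open>2A - M J\<close> in the case of equality.\<close>

definition c :: real where "c = M * sqrt (real m * real n / real k)"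

lemma M_nonneg: "0 \<le> M" using b_bound[OF m n] by linarith

lemma c_squared: "c\<^sup>2 * real k = M\<^sup>2 * (real m * real n)"
  using k by (simp add: c_def power_mult_distrib)

text \<open>\<open>c\<close> is chosen so that \<open>c\<close> times the Cauchy-Schwarz bound
  equals \<open>M\<^sup>2 m n\<close>, the largest possible squared norm of
  \<open>b\<close>.\<close>

lemma c_mult: "c * (M * sqrt (real m * real n * real k)) = M\<^sup>2 * (real m * real n)"
proof -
  have "sqrt (real m * real n / real k) * sqrt (real m * real n * real k) = real m * real n"
  proof -
    have "real m * real n / real k * (real m * real n * real k) = (real m * real n)\<^sup>2"
      using k by (simp add: power2_eq_square)
    then show ?thesis unfolding real_sqrt_mult[symmetric] by simp
  qed
  then show ?thesis by (simp add: c_def power2_eq_square)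
qed

lemma sum_b_squared_le: "(\<Sum>i<m. \<Sum>j<n. (b i j)\<^sup>2) \<le> M\<^sup>2 * (real m * real n)"
proof -
  have "(\<Sum>i<m. \<Sum>j<n. (b i j)\<^sup>2) \<le> (\<Sum>i<m. \<Sum>j<n. M\<^sup>2)"
    by (intro sum_mono) (use b_bound M_nonneg in \<open>auto simp: abs_le_square_iff[symmetric]\<close>)
  then show ?thesis by (simp add: mult_ac)
qed

lemma pairing_split:
  "2 * Re (\<Sum>i<m. \<Sum>j<n. cnj (W i j) * A $$ (i, j)) =
    (\<Sum>i<m. \<Sum>j<n. b i j * Re (W i j)) + M * (\<Sum>i<m. \<Sum>j<n. Re (W i j))"
proof -
  have "2 * Re (cnj (W i j) * A $$ (i, j)) = b i j * Re (W i j) + M * Re (W i j)"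
    if "i < m" "j < n" for i j
    unfolding entry[OF that] by (simp add: algebra_simps del: of_real_add of_real_divide)
  then have "2 * Re (\<Sum>i<m. \<Sum>j<n. cnj (W i j) * A $$ (i, j)) =
    (\<Sum>i<m. \<Sum>j<n. b i j * Re (W i j) + M * Re (W i j))"
    unfolding Re_sum sum_distrib_left by simp
  then show ?thesis by (simp add: sum.distrib sum_distrib_left)
qed

text \<open>Cauchy-Schwarz is derived from this distance because its vanishing gives the equality
  case \<open>b = c W\<close> at once.\<close>

lemma distance_expansion:
  "(\<Sum>i<m. \<Sum>j<n. (cmod (complex_of_real (b i j) - complex_of_real c * W i j))\<^sup>2) =
    (\<Sum>i<m. \<Sum>j<n. (b i j)\<^sup>2) - 2 * c * (\<Sum>i<m. \<Sum>j<n. b i j * Re (W i j))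
      + c\<^sup>2 * (\<Sum>i<m. \<Sum>j<n. (cmod (W i j))\<^sup>2)"
proof -
  have "(cmod (complex_of_real (b i j) - complex_of_real c * W i j))\<^sup>2 =
    (b i j)\<^sup>2 - 2 * c * (b i j * Re (W i j)) + c\<^sup>2 * (cmod (W i j))\<^sup>2" for i j
    unfolding cmod_power2 by (simp add: power2_eq_square algebra_simps)
  then show ?thesis by (simp add: sum.distrib sum_subtractf sum_distrib_left)
qed

text \<open>The distance is nonnegative and both of its square terms are at most
  \<open>M\<^sup>2 m n\<close>, which bounds the cross term; then \<open>c\<close> is cancelled. For
  \<open>M = 0\<close> it cannot be cancelled, but there \<open>b\<close> vanishes.\<close>

lemma correlation_le:
  assumes W: "(\<Sum>i<m. \<Sum>j<n. (cmod (W i j))\<^sup>2) \<le> real k"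
  shows "(\<Sum>i<m. \<Sum>j<n. b i j * Re (W i j)) \<le> M * sqrt (real m * real n * real k)"
proof (cases "M = 0")
  case True
  then show ?thesis using b_bound by simp
next
  case False
  then have c: "0 < c" using M_nonneg m n k by (simp add: c_def)
  have "0 \<le> (\<Sum>i<m. \<Sum>j<n. (cmod (complex_of_real (b i j) - complex_of_real c * W i j))\<^sup>2)"
    by (intro sum_nonneg) auto
  then have "c * (\<Sum>i<m. \<Sum>j<n. b i j * Re (W i j)) \<le> c * (M * sqrt (real m * real n * real k))"
    using sum_b_squared_le mult_left_mono[OF W, of "c\<^sup>2"] c_squared
    unfolding distance_expansion c_mult by simp
  then show ?thesis using c by simp
qed

text \<open>In the case of equality the distance is the sum of two nonpositive differences, namely
  the squared norms of \<open>b\<close> and of \<open>c W\<close>, each minus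
  \<open>M\<^sup>2 m n\<close>. All three must vanish, which yields the modulus of the entries of
  \<open>b\<close>, the norm of \<open>W\<close> and \<open>b = c W\<close>.\<close>

lemma correlation_eqD:
  assumes W: "(\<Sum>i<m. \<Sum>j<n. (cmod (W i j))\<^sup>2) \<le> real k"
    and eq: "(\<Sum>i<m. \<Sum>j<n. b i j * Re (W i j)) = M * sqrt (real m * real n * real k)" and M: "M \<noteq> 0"
  shows "(\<Sum>i<m. \<Sum>j<n. (cmod (W i j))\<^sup>2) = real k"
    and "i < m \<Longrightarrow> j < n \<Longrightarrow> \<bar>b i j\<bar> = M"
    and "i < m \<Longrightarrow> j < n \<Longrightarrow> complex_of_real (b i j) = complex_of_real c * W i j"
proof -
  let ?S = "\<Sum>i<m. \<Sum>j<n. (cmod (complex_of_real (b i j) - complex_of_real c * W i j))\<^sup>2"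
  let ?N = "\<Sum>i<m. \<Sum>j<n. (cmod (W i j))\<^sup>2"
  have c: "0 < c" using M M_nonneg m n k by (simp add: c_def)
  have S0: "0 \<le> ?S" by (intro sum_nonneg) auto
  have S: "?S = (\<Sum>i<m. \<Sum>j<n. (b i j)\<^sup>2) - 2 * (M\<^sup>2 * (real m * real n)) + c\<^sup>2 * ?N"
    unfolding distance_expansion eq using c_mult by simp
  have N: "c\<^sup>2 * ?N \<le> M\<^sup>2 * (real m * real n)"
    using mult_left_mono[OF W, of "c\<^sup>2"] c_squared by simp
  have "c\<^sup>2 * ?N = c\<^sup>2 * real k" using S S0 N sum_b_squared_le c_squared by linarith
  then show "?N = real k" using c by simp
  have "(\<Sum>i<m. \<Sum>j<n. M\<^sup>2 - (b i j)\<^sup>2) = M\<^sup>2 * (real m * real n) - (\<Sum>i<m. \<Sum>j<n. (b i j)\<^sup>2)"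
    by (simp add: sum_subtractf mult_ac)
  also have "\<dots> = 0" using S S0 N sum_b_squared_le by linarith
  finally have B: "(\<Sum>i<m. \<Sum>j<n. M\<^sup>2 - (b i j)\<^sup>2) = 0" .
  have Sz: "?S = 0" using S S0 N sum_b_squared_le by linarith
  show "\<bar>b i j\<bar> = M" if "i < m" "j < n"
  proof -
    have "M\<^sup>2 - (b i j)\<^sup>2 = 0"
      using double_sum_nonneg_eq_0D[OF B _ that] b_bound M_nonneg
      by (force simp: abs_le_square_iff[symmetric])
    then show ?thesis using M_nonneg by (metis abs_of_nonneg eq_iff_diff_eq_0 power2_eq_iff_nonneg abs_ge_zero power2_abs)
  qed
  show "complex_of_real (b i j) = complex_of_real c * W i j" if "i < m" "j < n"
    using double_sum_nonneg_eq_0D[OF Sz _ that] by simp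
qed

text \<open>Two separate upper bounds add up to the claim, so equality of the totals forces equality
  in each. All \<open>m\<close> left vectors are kept, since a decomposition of
  \<open>2A - M J\<close> is to be assembled from them.\<close>

lemma ky_fan_norm_le:
  "ky_fan_norm k A \<le> 1 / 2 * (1 + sqrt (real k)) * sqrt (real m * real n) * M"
  and ky_fan_norm_eqD:
  "ky_fan_norm k A = 1 / 2 * (1 + sqrt (real k)) * sqrt (real m * real n) * M \<Longrightarrow> M \<noteq> 0 \<Longrightarrow>
    \<exists>U V. semi_orthonormal (\<lambda>_. True) m m U \<and> semi_orthonormal (\<lambda>_. True) k n V \<and>
      (\<forall>i<m. \<forall>j<n. \<bar>b i j\<bar> = M \<and> complex_of_real (b i j) = complex_of_real c * partial_isometry k U V i j) \<and>
      (\<Sum>i<m. \<Sum>j<n. Re (partial_isometry k U V i j)) = sqrt (real m * real n)"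
proof -
  obtain U V where UV: "singular_decomposition m n (singular_values A) U V A"
    using singular_decomposition_exists[OF A] by blast
  define s where "s = singular_values A"
  note o = singular_decomposition_orthonormal[OF UV k(2), folded s_def]
  let ?W = "partial_isometry k U V"
  let ?X = "\<Sum>i<m. \<Sum>j<n. b i j * Re (?W i j)" and ?Y = "\<Sum>i<m. \<Sum>j<n. Re (?W i j)"
  have KF: "2 * ky_fan_norm k A = ?X + M * ?Y"
    unfolding pairing_split[symmetric] ky_fan_norm_attained[OF UV k(2)] by simp
  have Nk: "(\<Sum>i<m. \<Sum>j<n. (cmod (?W i j))\<^sup>2) = (\<Sum>p<k. of_bool (s ! p \<noteq> 0))"
    using partial_isometry_norm[OF o] by simp
  have N: "(\<Sum>i<m. \<Sum>j<n. (cmod (?W i j))\<^sup>2) \<le> real k"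
    unfolding Nk using sum_mono[of "{..<k}" "\<lambda>p. of_bool (s ! p \<noteq> 0)" "\<lambda>_. 1::real"] by simp
  note X = correlation_le[OF N]
  have Y: "?Y \<le> sqrt (real m * real n)" by (rule partial_isometry_sum_le[OF o m n])
  have bound: "2 * (1 / 2 * (1 + sqrt (real k)) * sqrt (real m * real n) * M) =
      M * sqrt (real m * real n * real k) + M * sqrt (real m * real n)"
    by (simp add: real_sqrt_mult algebra_simps)
  have MY: "M * ?Y \<le> M * sqrt (real m * real n)" using Y M_nonneg by (rule mult_left_mono)
  show "ky_fan_norm k A \<le> 1 / 2 * (1 + sqrt (real k)) * sqrt (real m * real n) * M"
    using KF X MY bound by linarith
  assume eq: "ky_fan_norm k A = 1 / 2 * (1 + sqrt (real k)) * sqrt (real m * real n) * M" and M: "M \<noteq> 0"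
  have X_eq: "?X = M * sqrt (real m * real n * real k)" using KF X MY bound eq by linarith
  have "M * ?Y = M * sqrt (real m * real n)" using KF X MY bound eq by linarith
  then have Y_eq: "?Y = sqrt (real m * real n)" using M by simp
  note D = correlation_eqD[OF N X_eq M]
  \<comment> \<open>The squared norm of the partial isometry counts the nonzero values among the
    first \<open>k\<close>. As it equals \<open>k\<close>, none of them is zero, and
    \<open>V\<close> is orthonormal.\<close>
  have "(\<Sum>p<k. 1 - of_bool (s ! p \<noteq> 0) :: real) = 0"
    using D(1) unfolding Nk sum_subtractf by simp
  then have "\<forall>p<k. s ! p \<noteq> 0" by (subst (asm) sum_nonneg_eq_0_iff) auto
  then have "semi_orthonormal (\<lambda>_. True) k n V" using o(2) by (simp add: semi_orthonormal_def)
  then show "\<exists>U V. semi_orthonormal (\<lambda>_. True) m m U \<and> semi_orthonormal (\<lambda>_. True) k n V \<and>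
      (\<forall>i<m. \<forall>j<n. \<bar>b i j\<bar> = M \<and> complex_of_real (b i j) = complex_of_real c * partial_isometry k U V i j) \<and>
      (\<Sum>i<m. \<Sum>j<n. Re (partial_isometry k U V i j)) = sqrt (real m * real n)"
    using D(2,3) Y_eq singular_decomposition_orthonormal(1)[OF UV order_refl] by blast
qed

end

text \<open>Used to pass from the number of nonzero singular values to their positions in the
  list.\<close>

lemma decreasing_filter_nonzero:
  fixes s :: "real list"
  assumes "sorted_wrt (\<ge>) s" "\<forall>x \<in> set s. 0 \<le> x"
  shows "s = filter (\<lambda>x. x \<noteq> 0) s @ replicate (length s - length (filter (\<lambda>x. x \<noteq> 0) s)) 0"
  using assms
proof (induction s)
  case (Cons x s)
  show ?case
  proof (cases "x = 0")
    case True
    then have "\<forall>y \<in> set s. y = 0" using Cons.prems by (auto intro: antisym)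
    then have "filter (\<lambda>x. x \<noteq> 0) s = []" "s = replicate (length s) 0"
      by (auto simp: filter_empty_conv intro!: replicate_eqI)
    then show ?thesis using True by simp
  next
    case False
    then show ?thesis using Cons by simp
  qed
qed simp

section \<open>The equality case in terms of the centred matrix\<close>

context centred_nonneg_matrix
begin

definition B :: "complex mat" where
  "B = 2 \<cdot>\<^sub>m A - complex_of_real M \<cdot>\<^sub>m all_ones_mat m n"

lemma B_carrier: "B \<in> carrier_mat m n"
  using A unfolding B_def all_ones_mat_def by (intro carrier_matI) auto

lemma B_index: "i < m \<Longrightarrow> j < n \<Longrightarrow> B $$ (i, j) = complex_of_real (b i j)"
  using A by (simp add: B_def all_ones_mat_def entry add_divide_distrib)

lemma plain_B_iff:
  "plain B \<longleftrightarrow> singular_value 1 B * sqrt (real m * real n) = (\<Sum>i<m. \<Sum>j<n. b i j)"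
proof -
  have "all_ones_vec m \<bullet>c (B *\<^sub>v all_ones_vec n) = complex_of_real (\<Sum>i<m. \<Sum>j<n. b i j)"
    using B_carrier
    by (simp add: all_ones_vec_def scalar_prod_def atLeast0LessThan B_index)
  then have "plain B \<longleftrightarrow> complex_of_real (singular_value 1 B) =
      complex_of_real ((\<Sum>i<m. \<Sum>j<n. b i j) / sqrt (real m * real n))"
    using B_carrier unfolding plain_def by simp
  also have "\<dots> \<longleftrightarrow> singular_value 1 B = (\<Sum>i<m. \<Sum>j<n. b i j) / sqrt (real m * real n)"
    by (simp only: of_real_eq_iff)
  finally show ?thesis using m n by (simp add: eq_divide_eq)
qed

lemma c_pos: "M \<noteq> 0 \<Longrightarrow> 0 < c"
  using M_nonneg m n k by (simp add: c_def)

text \<open>Up to padding with zeros, \<open>B = c W\<close> already is a singular value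
  decomposition of \<open>B\<close>, with \<open>c\<close> repeated \<open>k\<close> times.
  Plainness follows as the entries of \<open>W\<close> sum to \<open>sqrt (m n)\<close>.\<close>

lemma equality_imp_structure:
  assumes eq: "ky_fan_norm k A = 1 / 2 * (1 + sqrt (real k)) * sqrt (real m * real n) * M" and M: "M \<noteq> 0"
  shows "\<And>i j. i < m \<Longrightarrow> j < n \<Longrightarrow> \<bar>b i j\<bar> = M" "plain B" "has_exactly_equal_nonzero_singular_values k B"
proof -
  obtain U V where U: "semi_orthonormal (\<lambda>_. True) m m U" and V: "semi_orthonormal (\<lambda>_. True) k n V"
    and b: "\<And>i j. i < m \<Longrightarrow> j < n \<Longrightarrow> \<bar>b i j\<bar> = M"
    and bW: "\<And>i j. i < m \<Longrightarrow> j < n \<Longrightarrow> complex_of_real (b i j) = complex_of_real c * partial_isometry k U V i j"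
    and sum_W: "(\<Sum>i<m. \<Sum>j<n. Re (partial_isometry k U V i j)) = sqrt (real m * real n)"
    using ky_fan_norm_eqD[OF assms] by blast
  show "\<And>i j. i < m \<Longrightarrow> j < n \<Longrightarrow> \<bar>b i j\<bar> = M" by (rule b)
  define s where "s = replicate k c @ replicate (m - k) 0"
  \<comment> \<open>Right vectors from index \<open>k\<close> on belong to the singular value 0 and
    have to be zero vectors.\<close>
  define V' where "V' p = (if p < k then V p else (\<lambda>_. 0))" for p
  have sp: "s ! p = (if p < k then c else 0)" if "p < m" for p
    using that by (simp add: s_def nth_append)
  have "singular_decomposition m n s U V' B"
    unfolding singular_decomposition_def
  proof (intro conjI allI impI)
    fix p q assume pq: "p < m" "q < m"
    show "(\<Sum>i<m. cnj (U p i) * U q i) = of_bool (p = q)" using semi_orthonormalD[OF U pq] by simp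
    show "(\<Sum>j<n. cnj (V' p j) * V' q j) = of_bool (p = q \<and> s ! p \<noteq> 0)"
      using semi_orthonormalD[OF V, of p q] c_pos[OF M] pq by (auto simp: V'_def sp)
  next
    fix i j assume ij: "i < m" "j < n"
    have "(\<Sum>p<m. complex_of_real (s ! p) * U p i * cnj (V' p j)) =
      (\<Sum>p<k. complex_of_real c * (U p i * cnj (V p j)))"
      using k(2) by (intro sum.mono_neutral_cong_right) (auto simp: sp V'_def)
    then show "B $$ (i, j) = (\<Sum>p<m. complex_of_real (s ! p) * U p i * cnj (V' p j))"
      using ij bW by (simp add: B_index partial_isometry_def sum_distrib_left)
  qed (use B_carrier k c_pos[OF M] in \<open>auto simp: s_def sorted_wrt_iff_nth_less nth_append\<close>)
  then have sv: "singular_values B = s" by (rule singular_values_eqI)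
  have "b i j = c * Re (partial_isometry k U V i j)" if "i < m" "j < n" for i j
    using arg_cong[OF bW[OF that], of Re] by simp
  then have "(\<Sum>i<m. \<Sum>j<n. b i j) = c * sqrt (real m * real n)"
    by (simp add: sum_W[symmetric] sum_distrib_left)
  moreover have "singular_value 1 B = c" using k by (simp add: singular_value_def sv sp)
  ultimately show "plain B" by (simp add: plain_B_iff)
  show "has_exactly_equal_nonzero_singular_values k B"
    using c_pos[OF M] by (simp add: has_exactly_equal_nonzero_singular_values_def sv s_def)
qed

lemma structure_imp_equality:
  assumes b: "\<And>i j. i < m \<Longrightarrow> j < n \<Longrightarrow> \<bar>b i j\<bar> = M" and M: "M \<noteq> 0"
    and plain: "plain B" and equal: "has_exactly_equal_nonzero_singular_values k B"
  shows "ky_fan_norm k A = 1 / 2 * (1 + sqrt (real k)) * sqrt (real m * real n) * M"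
proof -
  define s where "s = singular_values B"
  obtain U V where UV: "singular_decomposition m n s U V B"
    using singular_decomposition_exists[OF B_carrier] unfolding s_def by blast
  have s: "sorted_wrt (\<ge>) s" "\<forall>x \<in> set s. 0 \<le> x" "length s = m"
    using UV by (auto simp: singular_decomposition_def)
  define nz where "nz = filter (\<lambda>x. x \<noteq> 0) s"
  have nz: "length nz = k" "\<forall>x \<in> set nz. \<forall>y \<in> set nz. x = y"
    using equal by (auto simp: has_exactly_equal_nonzero_singular_values_def s_def[symmetric] nz_def Let_def)
  define r where "r = nz ! 0"
  have r_in: "r \<in> set nz" using nz(1) k by (simp add: r_def)
  then have r: "0 < r" using s(2) by (auto simp: nz_def less_le)
  have "nz = replicate k r" using nz r_in by (intro replicate_eqI) auto
  then have "s = replicate k r @ replicate (m - k) 0"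
    using decreasing_filter_nonzero[OF s(1,2)] s(3) nz(1) unfolding nz_def by simp
  then have sp: "s ! p = (if p < k then r else 0)" if "p < m" for p
    using that by (simp add: nth_append)
  have o: "semi_orthonormal (\<lambda>_. True) k m U" "semi_orthonormal (\<lambda>_. True) k n V"
    using singular_decomposition_orthonormal[OF UV k(2)] k(2) r by (auto simp: semi_orthonormal_def sp)
  let ?W = "partial_isometry k U V"
  have W: "?W i j = complex_of_real (b i j / r)" if "i < m" "j < n" for i j
  proof -
    have "complex_of_real (b i j) = (\<Sum>p<m. complex_of_real (s ! p) * U p i * cnj (V p j))"
      using UV that by (simp add: singular_decomposition_def B_index)
    also have "\<dots> = (\<Sum>p<k. complex_of_real r * (U p i * cnj (V p j)))"
      using k(2) by (intro sum.mono_neutral_cong_right) (auto simp: sp)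
    finally have "complex_of_real (b i j) = complex_of_real r * ?W i j"
      by (simp add: partial_isometry_def sum_distrib_left)
    then show ?thesis using r by simp
  qed
  have bb: "b i j * b i j = M\<^sup>2" if "i < m" "j < n" for i j
    using b[OF that] by (metis power2_abs power2_eq_square)
  \<comment> \<open>The squared norm of \<open>?W\<close> is evaluated in two ways, as its rank
    \<open>k\<close> and from its entries of modulus \<open>M / r\<close>; this identifies
    \<open>r\<close> with \<open>c\<close>.\<close>
  have "real k = (\<Sum>i<m. \<Sum>j<n. (cmod (?W i j))\<^sup>2)" by (simp add: partial_isometry_norm[OF o])
  also have "\<dots> = real m * real n * M\<^sup>2 / r\<^sup>2"
    using r b by (simp add: W norm_divide power_divide)
  finally have "r\<^sup>2 * real k = M\<^sup>2 * (real m * real n)" using r by (simp add: field_simps)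
  then have "r\<^sup>2 = c\<^sup>2" using c_squared k by (metis mult_cancel_right not_one_le_zero of_nat_eq_0_iff)
  then have rc: "r = c" using r c_pos[OF M] by (simp add: power2_eq_iff)
  have "(\<Sum>i<m. \<Sum>j<n. b i j * Re (?W i j)) = M\<^sup>2 * (real m * real n) / r"
    by (simp add: W bb)
  also have "\<dots> = M * sqrt (real m * real n * real k)"
    using c_mult r unfolding rc by (simp add: field_simps)
  finally have X: "(\<Sum>i<m. \<Sum>j<n. b i j * Re (?W i j)) = M * sqrt (real m * real n * real k)" .
  \<comment> \<open>Plainness makes the entry sum of \<open>?W\<close> as large as that of a
    contraction can be.\<close>
  have "singular_value 1 B = r" using k by (simp add: singular_value_def sp flip: s_def)
  then have "(\<Sum>i<m. \<Sum>j<n. b i j) = r * sqrt (real m * real n)" using plain by (simp add: plain_B_iff)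
  then have Y: "(\<Sum>i<m. \<Sum>j<n. Re (?W i j)) = sqrt (real m * real n)"
    using r by (simp add: W flip: sum_divide_distrib)
  \<comment> \<open>\<open>?W\<close> stems from singular vectors of \<open>B\<close>, not of
    \<open>A\<close>, so duality is what gives a lower bound for the norm of
    \<open>A\<close>.\<close>
  have "M * sqrt (real m * real n * real k) + M * sqrt (real m * real n) \<le> 2 * ky_fan_norm k A"
    using pairing_split[of ?W] ky_fan_norm_dual_bound[OF A k o] unfolding X Y by simp
  moreover have "2 * (1 / 2 * (1 + sqrt (real k)) * sqrt (real m * real n) * M) =
      M * sqrt (real m * real n * real k) + M * sqrt (real m * real n)"
    by (simp add: real_sqrt_mult algebra_simps)
  ultimately show ?thesis using ky_fan_norm_le by linarith
qed

end

section \<open>Specialization to nonnegative matrices\<close>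

theorem theorem13:
  fixes A :: "complex mat" and m n k :: nat
  assumes "n \<ge> m" and "m \<ge> 2" and "m \<ge> k" and "k \<ge> 1"
    and "A \<in> carrier_mat m n"
    and "nonnegative_mat A"
  shows "ky_fan_norm k A \<le> 1 / 2 * (1 + sqrt (real k)) * sqrt (real m * real n) * max_norm A \<and>
    (ky_fan_norm k A = 1 / 2 * (1 + sqrt (real k)) * sqrt (real m * real n) * max_norm A \<longleftrightarrow>
       A = 0\<^sub>m m n \<or>
       (\<exists>c Z. Z \<in> carrier_mat m n \<and> zero_one_mat Z \<and> A = c \<cdot>\<^sub>m Z) \<and>
       plain (2 \<cdot>\<^sub>m A - complex_of_real (max_norm A) \<cdot>\<^sub>m all_ones_mat m n) \<and>
       has_exactly_equal_nonzero_singular_values k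
         (2 \<cdot>\<^sub>m A - complex_of_real (max_norm A) \<cdot>\<^sub>m all_ones_mat m n))"
proof -
  define M where "M = max_norm A"
  define b where "b i j = 2 * Re (A $$ (i, j)) - M" for i j
  have mn: "0 < m" "0 < n" using assms by auto
  have Aij: "A $$ (i, j) = complex_of_real (Re (A $$ (i, j)))" "0 \<le> Re (A $$ (i, j))"
    "Re (A $$ (i, j)) \<le> M" if "i < m" "j < n" for i j
  proof -
    have "A $$ (i, j) \<in> \<real>\<^sub>\<ge>\<^sub>0"
      using assms(6) elements_matI[OF assms(5) that refl] unfolding nonnegative_mat_def by blast
    then show "A $$ (i, j) = complex_of_real (Re (A $$ (i, j)))" "0 \<le> Re (A $$ (i, j))"
      by (auto simp: complex_nonneg_Reals_iff complex_eq_iff)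
    show "Re (A $$ (i, j)) \<le> M"
      using cmod_le_max_norm[OF assms(5) that] complex_Re_le_cmod order_trans unfolding M_def by blast
  qed
  interpret centred_nonneg_matrix A m n k b M
  proof
    fix i j assume ij: "i < m" "j < n"
    show "A $$ (i, j) = complex_of_real ((b i j + M) / 2)" using Aij(1)[OF ij] by (simp add: b_def)
    show "\<bar>b i j\<bar> \<le> M" using Aij(2,3)[OF ij] by (simp add: b_def abs_le_iff)
  qed (use assms mn in auto)
  have zero: "A = 0\<^sub>m m n \<longleftrightarrow> M = 0"
  proof
    assume "A = 0\<^sub>m m n"
    then show "M = 0" using max_norm_attained[OF assms(5) mn] unfolding M_def by (metis index_zero_mat(1) norm_zero)
  next
    assume "M = 0"
    then show "A = 0\<^sub>m m n"
      using cmod_le_max_norm[OF assms(5)] assms(5) unfolding M_def by (intro eq_matI) fastforce+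
  qed
  \<comment> \<open>The zero matrix is split off: there the upper bound is 0 and the norm is
    nonnegative.\<close>
  have equality0: "ky_fan_norm k A = 1 / 2 * (1 + sqrt (real k)) * sqrt (real m * real n) * M" if "M = 0"
  proof -
    obtain U V where "singular_decomposition m n (singular_values A) U V A"
      using singular_decomposition_exists[OF assms(5)] by blast
    then have "0 \<le> ky_fan_norm k A"
      using assms(3) by (auto simp: ky_fan_norm_eq_sum singular_decomposition_def intro!: sum_nonneg)
    then show ?thesis using ky_fan_norm_le that by simp
  qed
  \<comment> \<open>Entries \<open>M\<close> and \<open>-M\<close> of the centred matrix correspond
    to entries \<open>M\<close> and \<open>0\<close> of \<open>A\<close>.\<close>
  have two_valued: "(\<exists>c Z. Z \<in> carrier_mat m n \<and> zero_one_mat Z \<and> A = c \<cdot>\<^sub>m Z) \<longleftrightarrow>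
      (\<forall>i<m. \<forall>j<n. \<bar>b i j\<bar> = M)" if M: "M \<noteq> 0"
  proof
    assume "\<exists>c Z. Z \<in> carrier_mat m n \<and> zero_one_mat Z \<and> A = c \<cdot>\<^sub>m Z"
    then obtain d Z where Z: "Z \<in> carrier_mat m n" "zero_one_mat Z" and AZ: "A = d \<cdot>\<^sub>m Z" by blast
    have Zij: "A $$ (i, j) \<in> {0, d}" if "i < m" "j < n" for i j
      using Z elements_matI[OF Z(1) that refl] that by (auto simp: AZ zero_one_mat_def)
    \<comment> \<open>An entry of largest modulus is nonzero, so it equals \<open>d\<close>; being a
      nonnegative real, it shows that \<open>d\<close> has real part \<open>M\<close>.\<close>
    obtain i j where ij: "i < m" "j < n" and Mij: "M = cmod (A $$ (i, j))"
      using max_norm_attained[OF assms(5) mn] unfolding M_def by blast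
    have "A $$ (i, j) = d" using Zij[OF ij] Mij M by auto
    moreover have "cmod (A $$ (i, j)) = Re (A $$ (i, j))"
      using Aij(1,2)[OF ij] by (metis norm_of_real abs_of_nonneg)
    ultimately have "Re d = M" using Mij by simp
    then show "\<forall>i<m. \<forall>j<n. \<bar>b i j\<bar> = M" using Zij M_nonneg by (force simp: b_def)
  next
    assume bM: "\<forall>i<m. \<forall>j<n. \<bar>b i j\<bar> = M"
    define Z where "Z = mat m n (\<lambda>ij. A $$ ij / complex_of_real M)"
    have "A = complex_of_real M \<cdot>\<^sub>m Z" using assms(5) M by (intro eq_matI) (auto simp: Z_def)
    moreover have "zero_one_mat Z"
    proof -
      have "A $$ (i, j) = 0 \<or> A $$ (i, j) = complex_of_real M" if "i < m" "j < n" for i j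
      proof -
        have "\<bar>b i j\<bar> = M" using bM that by blast
        then have "b i j = M \<or> b i j = - M" by (auto simp: abs_if split: if_splits)
        then show ?thesis using entry[OF that] by auto
      qed
      then show ?thesis using M unfolding zero_one_mat_def Z_def by (fastforce dest!: elements_matD)
    qed
    ultimately show "\<exists>c Z. Z \<in> carrier_mat m n \<and> zero_one_mat Z \<and> A = c \<cdot>\<^sub>m Z"
      by (intro exI[of _ "complex_of_real M"] exI[of _ Z]) (simp add: Z_def)
  qed
  show ?thesis
    unfolding M_def[symmetric] B_def[symmetric] zero
    using ky_fan_norm_le equality0 two_valued equality_imp_structure structure_imp_equality by blast
qed

end
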